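(* Let $m,n$ be positive integers, and let $P_\ell$ denote the path with $\ell$ edges. Then \[\rho(P_m,P_n)=\begin{cases} \frac{n}{m} & \text{if } n>m \text{ and } n \text{ is even},\\[2pt] \frac{n}{m} & \text{if } n>m,\ n \text{ is odd and } m \text{ is odd},\\[2pt] \frac{n+1}{m} & \text{if } n \text{ is odd and } m \text{ is even},\\[2pt] \frac{n+1}{m+1} & \text{if } n<m \text{ and } n \text{ is even},\\[2pt] \frac{n+1}{m+1} & \text{if } n<m,\ n \text{ and } m \text{ are both odd, and } (n+1)\mid (m+1). \end{cases}\]
   Context: A graphon is a symmetric measurable function $W:[0,1]^2\to[0,1]$. For a finite simple graph $G$ with vertices $v_1,\dots,v_n$, put $t(G,W)=\int_{[0,1]^n}\prod_{v_iv_j\in E(G)}W(x_i,x_j)\,dx_1\cdots dx_n$; for a finite graph $W$ (loops allowed), $t(G,W)=\hom(G,W)/|V(W)|^{|V(G)|}$, where $\hom(G,W)$ is the number of maps $V(G)\to V(W)$ sending edges to edges. For finite simple graphs $G,H$, the density domination exponent is $\rho(G,H)=\sup_W \frac{\log t(H,W)}{\log t(G,W)}\in[0,\infty]$, where $W$ ranges over all graphons (equivalently, all finite graphs) with $t(G,W)\ne 0$. Conventions: those $W$ with $t(G,W)=1$, where the quotient is undefined, are omitted; $\log 0=-\infty$, so the quotient is $+\infty$ if $t(H,W)=0$. Thus, when $G$ has at least one edge, for $c>0$ one has $\rho(G,H)\le c$ if and only if $t(H,W)\ge t(G,W)^c$ for every $W$. *)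

theory Defs
  imports "HOL-Analysis.Analysis"
begin

text \<open>Edges are two-element vertex sets.\<close>

record 'a graph =
  verts :: "'a set"
  edges :: "'a set set"

definition finite_simple_graph :: "'a graph \<Rightarrow> bool" where
  "finite_simple_graph G \<longleftrightarrow>
     finite (verts G) \<and> (\<forall>e \<in> edges G. e \<subseteq> verts G \<and> card e = 2)"

definition path_graph :: "nat \<Rightarrow> nat graph" where
  "path_graph l = \<lparr> verts = {0..l}, edges = {{i, Suc i} | i. i < l} \<rparr>"

lemma finite_simple_graph_path_graph: "finite_simple_graph (path_graph l)"
  by (auto simp: finite_simple_graph_def path_graph_def)

text \<open>Measurability is with respect to the Lebesgue sigma-algebra of the unit square. The values
  of \<open>W\<close> outside the unit square are unconstrained and never used.\<close>

definition graphon :: "(real \<Rightarrow> real \<Rightarrow> real) \<Rightarrow> bool" where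
  "graphon W \<longleftrightarrow>
     (\<lambda>(x, y). W x y) \<in> borel_measurable (lebesgue_on ({0..1} \<times> {0..1})) \<and>
     (\<forall>x \<in> {0..1}. \<forall>y \<in> {0..1}. 0 \<le> W x y \<and> W x y \<le> 1 \<and> W x y = W y x)"

text \<open>The measure is the complete Lebesgue measure on the cube of functions from the vertex set to
  the unit interval; the completion is needed because \<open>W\<close> is only Lebesgue measurable. The linear
  order on vertices merely names the two endpoints of an edge; as \<open>W\<close> is symmetric, it does not
  affect the value.\<close>

definition hom_density :: "('a :: linorder) graph \<Rightarrow> (real \<Rightarrow> real \<Rightarrow> real) \<Rightarrow> real" where
  "hom_density G W =
     (LINT x | completion (PiM (verts G) (\<lambda>_. restrict_space lborel {0..1})).
        (\<Prod>e \<in> edges G. W (x (Min e)) (x (Max e))))"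

text \<open>The quotient \<open>log s / log t\<close>, for densities \<open>0 \<le> s \<le> 1\<close> and \<open>0 < t < 1\<close>, with
  \<open>log 0 = -\<infinity>\<close>. Both logarithms are nonpositive, so nothing is truncated by \<^const>\<open>ennreal\<close>.\<close>

definition log_quotient :: "real \<Rightarrow> real \<Rightarrow> ennreal" where
  "log_quotient s t = (if s = 0 then \<infinity> else ennreal (ln s / ln t))"

definition density_domination_exponent ::
    "('a :: linorder) graph \<Rightarrow> ('b :: linorder) graph \<Rightarrow> ennreal" where
  "density_domination_exponent G H =
     (SUP W \<in> {W. graphon W \<and> hom_density G W \<noteq> 0 \<and> hom_density G W \<noteq> 1}.
        log_quotient (hom_density H W) (hom_density G W))"

end

theory Submission
  imports Defs "HOL-Probability.Probability"
begin

text \<open>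
  Let \<open>F_k\<close> be the density of walks of length \<open>k\<close> from a given point and \<open>w_k = \<integral> F_k = t(P_k, W)\<close>, so that
  \<open>\<integral> F_i F_j = w_{i+j}\<close>. Three inequalities give all upper bounds: log-convexity
  \<open>w_{a+b}^2 \<le> w_{2a} w_{2b}\<close> (Cauchy--Schwarz), \<open>w_{a+b+1} \<le> w_a w_b\<close> (deleting an edge), and
  \<open>w_m^{m+2} \<le> w_{m+2}^m\<close>. The last one is an entropy argument: take a random \<open>m\<close>-walk, chosen with
  density proportional to its weight, and traverse its \<open>i\<close>-th edge back and forth once more; the
  entropy of the resulting walk of length \<open>m + 2\<close>, averaged over \<open>i\<close>, is \<open>1 + 2/m\<close> times that of the
  \<open>m\<close>-walk plus a term from the end vertices, which has the favourable sign.

  The lower bounds come from constant graphons (ratio \<open>n/m\<close>), from a clique on half of the vertices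
  (ratio \<open>(n+1)/(m+1)\<close>), and from complete bipartite graphons with parts of size \<open>a\<close> and \<open>1 - a\<close>,
  \<open>a \<rightarrow> 0\<close>, which behave like stars (ratio tending to \<open>(n+1)/m\<close> for \<open>m\<close> even and \<open>n\<close> odd).
\<close>

section \<open>Walk densities of a symmetric kernel\<close>

text \<open>Measurability refers to the plain product sigma-algebra, so that sections
  \<open>W x\<close> are measurable and Fubini applies directly. A graphon, only Lebesgue
  measurable, enters later through a Borel version.\<close>

locale symmetric_kernel = prob_space M for M :: "'a measure" +
  fixes W :: "'a \<Rightarrow> 'a \<Rightarrow> real"
  assumes measurable_W [measurable]: "case_prod W \<in> borel_measurable (M \<Otimes>\<^sub>M M)"
    and W_nonneg: "x \<in> space M \<Longrightarrow> y \<in> space M \<Longrightarrow> 0 \<le> W x y"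
    and W_le_1: "x \<in> space M \<Longrightarrow> y \<in> space M \<Longrightarrow> W x y \<le> 1"
    and W_sym: "x \<in> space M \<Longrightarrow> y \<in> space M \<Longrightarrow> W x y = W y x"
begin

sublocale pair: pair_prob_space M M ..

primrec walk :: "nat \<Rightarrow> 'a \<Rightarrow> real" where
  "walk 0 x = 1"
| "walk (Suc k) x = (\<integral>y. W x y * walk k y \<partial>M)"

definition path_density :: "nat \<Rightarrow> real" where
  "path_density k = (\<integral>x. walk k x \<partial>M)"

lemma measurable_walk [measurable]: "walk k \<in> borel_measurable M"
  by (induction k) auto

lemma integrable_bounded:
  fixes f :: "'a \<Rightarrow> real"
  assumes "f \<in> borel_measurable M" "\<And>x. x \<in> space M \<Longrightarrow> \<bar>f x\<bar> \<le> c"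
  shows "integrable M f"
  using assms by (intro integrable_const_bound[of _ c]) auto

lemma integrable_pair_bounded:
  fixes f :: "'a \<times> 'a \<Rightarrow> real"
  assumes "f \<in> borel_measurable (M \<Otimes>\<^sub>M M)"
    and "\<And>x y. x \<in> space M \<Longrightarrow> y \<in> space M \<Longrightarrow> \<bar>f (x, y)\<bar> \<le> c"
  shows "integrable (M \<Otimes>\<^sub>M M) f"
  using assms by (intro pair.P.integrable_const_bound[of _ c]) (auto simp: space_pair_measure)

lemma walk_bounds:
  assumes "x \<in> space M"
  shows "0 \<le> walk k x" "walk k x \<le> 1"
proof -
  have "0 \<le> walk k x \<and> walk k x \<le> 1" using assms
  proof (induction k arbitrary: x)
    case (Suc k)
    have [measurable]: "W x \<in> borel_measurable M" using Suc.prems by measurable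
    have *: "0 \<le> W x y * walk k y \<and> W x y * walk k y \<le> 1" if "y \<in> space M" for y
      using Suc that by (simp add: W_nonneg W_le_1 mult_le_one)
    have "integrable M (\<lambda>y. W x y * walk k y)"
      using * by (intro integrable_bounded[of _ 1]) (auto simp: abs_le_iff intro: order_trans[of _ 0])
    then show ?case
      using * by (auto intro!: integral_nonneg_AE integral_le_const)
  qed auto
  then show "0 \<le> walk k x" "walk k x \<le> 1" by auto
qed

lemma abs_walk_le: "x \<in> space M \<Longrightarrow> \<bar>walk k x\<bar> \<le> 1"
  using walk_bounds[of x k] by auto

lemma abs_W_le: "x \<in> space M \<Longrightarrow> y \<in> space M \<Longrightarrow> \<bar>W x y\<bar> \<le> 1"
  using W_nonneg[of x y] W_le_1[of x y] by auto

text \<open>Fubini for the bilinear form of \<open>W\<close>. By the symmetry of \<open>W\<close>,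
  the two iterated integrals express that the integral operator with kernel \<open>W\<close> is
  self-adjoint.\<close>

lemma integral_form_swap:
  fixes f g :: "'a \<Rightarrow> real"
  assumes [measurable]: "f \<in> borel_measurable M" "g \<in> borel_measurable M"
    and f: "\<And>x. x \<in> space M \<Longrightarrow> \<bar>f x\<bar> \<le> c" and g: "\<And>x. x \<in> space M \<Longrightarrow> \<bar>g x\<bar> \<le> d"
  shows "(\<integral>p. f (fst p) * W (fst p) (snd p) * g (snd p) \<partial>(M \<Otimes>\<^sub>M M))
           = (\<integral>x. f x * (\<integral>y. W x y * g y \<partial>M) \<partial>M)" (is ?A)
    and "(\<integral>p. f (fst p) * W (fst p) (snd p) * g (snd p) \<partial>(M \<Otimes>\<^sub>M M))
           = (\<integral>x. (\<integral>y. W x y * f y \<partial>M) * g x \<partial>M)" (is ?B)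
    and "integrable (M \<Otimes>\<^sub>M M) (\<lambda>p. f (fst p) * W (fst p) (snd p) * g (snd p))" (is ?C)
proof -
  have bd: "\<bar>f x * W x y * g y\<bar> \<le> c * 1 * d" if "x \<in> space M" "y \<in> space M" for x y
    using f[OF that(1)] g[OF that(2)] abs_W_le[OF that] unfolding abs_mult
    by (intro mult_mono) auto
  have int: "integrable (M \<Otimes>\<^sub>M M) (\<lambda>(x, y). f x * W x y * g y)"
    by (intro integrable_pair_bounded[of _ "c * 1 * d"]) (use bd in auto)
  then show ?C by (simp add: case_prod_unfold)
  have *: "(\<integral>p. f (fst p) * W (fst p) (snd p) * g (snd p) \<partial>(M \<Otimes>\<^sub>M M))
      = (\<integral>p. (\<lambda>(x, y). f x * W x y * g y) p \<partial>(M \<Otimes>\<^sub>M M))"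
    by (simp add: case_prod_unfold)
  have "\<dots> = (\<integral>x. \<integral>y. f x * W x y * g y \<partial>M \<partial>M)"
    using pair.integral_fst'[OF int] by simp
  then show ?A unfolding * by (simp add: mult.assoc)
  have "(\<integral>p. (\<lambda>(x, y). f x * W x y * g y) p \<partial>(M \<Otimes>\<^sub>M M)) = (\<integral>y. \<integral>x. f x * W x y * g y \<partial>M \<partial>M)"
    using pair.integral_snd[OF int] by simp
  also have "\<dots> = (\<integral>y. (\<integral>x. W y x * f x \<partial>M) * g y \<partial>M)"
  proof (intro Bochner_Integration.integral_cong refl)
    fix y assume y: "y \<in> space M"
    have "(\<integral>x. f x * W x y * g y \<partial>M) = (\<integral>x. (W y x * f x) * g y \<partial>M)"
      using y by (intro Bochner_Integration.integral_cong refl) (simp add: W_sym mult_ac)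
    then show "(\<integral>x. f x * W x y * g y \<partial>M) = (\<integral>x. W y x * f x \<partial>M) * g y"
      by simp
  qed
  finally show ?B unfolding * .
qed

lemma integral_walk_shift:
  fixes f :: "'a \<Rightarrow> real"
  assumes "f \<in> borel_measurable M" "\<And>x. x \<in> space M \<Longrightarrow> \<bar>f x\<bar> \<le> c"
  shows "(\<integral>x. walk k x * (\<integral>y. W x y * f y \<partial>M) \<partial>M) = (\<integral>x. walk (Suc k) x * f x \<partial>M)"
  using integral_form_swap(1,2)[of "walk k" f 1 c] assms abs_walk_le by simp

text \<open>Self-adjointness moves the steps of \<open>walk j\<close> one by one onto
  \<open>walk i\<close>, so it does not matter at which vertex a walk is cut.\<close>

lemma integral_walk_mult: "(\<integral>x. walk i x * walk j x \<partial>M) = path_density (i + j)"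
proof (induction j arbitrary: i)
  case (Suc j)
  have "(\<integral>x. walk i x * walk (Suc j) x \<partial>M) = (\<integral>x. walk (Suc i) x * walk j x \<partial>M)"
    using integral_walk_shift[of "walk j" 1 i] abs_walk_le by simp
  then show ?case using Suc[of "Suc i"] by simp
qed (simp add: path_density_def)

lemma integrable_walk_mult: "integrable M (\<lambda>x. walk i x * walk j x)"
proof (rule integrable_bounded[of _ 1])
  fix x assume "x \<in> space M"
  then show "\<bar>walk i x * walk j x\<bar> \<le> 1"
    using walk_bounds[of x] by (simp add: abs_mult mult_le_one)
qed auto

lemma integrable_walk: "integrable M (walk k)"
  using integrable_walk_mult[of k 0] by simp

section \<open>Log-convexity and edge deletion for path densities\<close>

lemma density_0 [simp]: "path_density 0 = 1"
  by (simp add: path_density_def prob_space)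

lemma density_nonneg: "0 \<le> path_density k"
  unfolding path_density_def by (intro integral_nonneg_AE) (auto simp: walk_bounds)

lemma density_le_1: "path_density k \<le> 1"
  unfolding path_density_def by (intro integral_le_const integrable_walk) (auto simp: walk_bounds)

lemma density_cauchy_schwarz: "(path_density (a + b))\<^sup>2 \<le> path_density (2 * a) * path_density (2 * b)"
proof -
  let ?A = "path_density (2 * a)" and ?B = "path_density (a + b)" and ?C = "path_density (2 * b)"
  \<comment> \<open>The claim is the discriminant inequality of this nonnegative quadratic form in
    \<open>s\<close> and \<open>t\<close>.\<close>
  have quad: "0 \<le> s\<^sup>2 * ?A - 2 * s * t * ?B + t\<^sup>2 * ?C" for s t :: real
  proof -
    have "0 \<le> (\<integral>x. (s * walk a x - t * walk b x)\<^sup>2 \<partial>M)" by simp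
    also have "(\<lambda>x. (s * walk a x - t * walk b x)\<^sup>2) = (\<lambda>x. s\<^sup>2 * (walk a x * walk a x)
        - 2 * s * t * (walk a x * walk b x) + t\<^sup>2 * (walk b x * walk b x))"
      by (auto simp: power2_eq_square algebra_simps)
    finally show ?thesis
      using integral_walk_mult[of a a] integral_walk_mult[of b b]
      by (simp add: integrable_walk_mult integral_walk_mult flip: mult_2)
  qed
  have nn: "0 \<le> ?A" "0 \<le> ?C" by (rule density_nonneg)+
  show ?thesis
  proof (cases "?A = 0")
    case True
    have "?B = 0"
    proof (rule ccontr)
      assume "?B \<noteq> 0"
      \<comment> \<open>With \<open>?A = 0\<close> and \<open>t = 1\<close> the form is affine in
        \<open>s\<close>, and this choice of \<open>s\<close> gives it the value
        \<open>-1\<close>.\<close>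
      then show False
        using quad[of "(?C + 1) / (2 * ?B)" 1] True by (simp add: field_simps)
    qed
    then show ?thesis using True by simp
  next
    case False
    then have "0 \<le> (?B\<^sup>2 * ?A - 2 * ?B * ?A * ?B + ?A\<^sup>2 * ?C)" using quad[of ?B ?A] by simp
    then have "0 \<le> ?A * (?A * ?C - ?B\<^sup>2)" by (simp add: power2_eq_square algebra_simps)
    then show ?thesis using False nn by (simp add: zero_le_mult_iff)
  qed
qed

lemma walk_Suc_le: "x \<in> space M \<Longrightarrow> walk (Suc k) x \<le> path_density k"
proof -
  assume x: "x \<in> space M"
  have [measurable]: "W x \<in> borel_measurable M" using x by measurable
  have "W x y * walk k y \<le> walk k y" "\<bar>W x y * walk k y\<bar> \<le> 1" if "y \<in> space M" for y
    using walk_bounds[OF that] abs_W_le[OF x that] W_nonneg[OF x that] W_le_1[OF x that]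
    by (auto simp: abs_mult mult_le_one mult_left_le_one_le)
  then show ?thesis
    unfolding path_density_def walk.simps
    by (intro integral_mono integrable_walk integrable_bounded[of _ 1]) auto
qed

text \<open>Since \<open>W \<le> 1\<close>, dropping the edge traversed after \<open>a\<close> steps
  can only increase the density, and what remains is a disjoint union of \<open>P_a\<close> and
  \<open>P_b\<close>.\<close>

lemma density_delete_edge: "path_density (a + Suc b) \<le> path_density a * path_density b"
proof -
  have "path_density (a + Suc b) = (\<integral>x. walk a x * walk (Suc b) x \<partial>M)"
    by (rule integral_walk_mult[symmetric])
  also have "\<dots> \<le> (\<integral>x. walk a x * path_density b \<partial>M)"
    by (intro integral_mono integrable_walk_mult integrable_mult_left integrable_walk mult_left_mono
        walk_Suc_le walk_bounds)
  also have "\<dots> = path_density a * path_density b" by (simp add: path_density_def)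
  finally show ?thesis .
qed

section \<open>Entropy comparison of walks of length \<open>m\<close> and
  \<open>m + 2\<close>\<close>

lemma walk_ge_power:
  assumes "0 < e" "\<And>x y. x \<in> space M \<Longrightarrow> y \<in> space M \<Longrightarrow> e \<le> W x y" and x: "x \<in> space M"
  shows "e ^ k \<le> walk k x"
  using x
proof (induction k arbitrary: x)
  case (Suc k)
  have [measurable]: "W x \<in> borel_measurable M" using Suc.prems by measurable
  have "integrable M (\<lambda>y. W x y * walk k y)"
    using Suc.prems abs_W_le abs_walk_le
    by (intro integrable_bounded[of _ 1]) (auto simp: abs_mult mult_le_one)
  moreover have "e ^ Suc k \<le> W x y * walk k y" if "y \<in> space M" for y
    using that Suc assms(1,2) W_nonneg by (auto intro!: mult_mono)
  ultimately show ?case by (auto intro!: integral_ge_const)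
qed auto

text \<open>The lower bound \<open>e\<close> keeps \<open>walk k\<close> above \<open>e ^ k\<close>,
  so that every logarithm in the entropy argument is finite and bounded. \<open>density_step\<close>
  removes the restriction.\<close>

lemma density_step_of_positive:
  assumes e: "0 < e" "\<And>x y. x \<in> space M \<Longrightarrow> y \<in> space M \<Longrightarrow> e \<le> W x y"
  shows "path_density m ^ (m + 2) \<le> path_density (m + 2) ^ m"
proof -
  have pos: "0 < walk k x" if "x \<in> space M" for k x
    using walk_ge_power[OF e that, of k] e(1) by (meson less_le_trans zero_less_power)
  have ln_bound: "\<bar>ln (walk k x)\<bar> \<le> - ln (e ^ k)" if "x \<in> space M" for k x
    using walk_ge_power[OF e that, of k] e(1) pos[OF that, of k] walk_bounds(2)[OF that, of k]
    by (simp add: abs_if)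
  have mult_ln_bound: "\<bar>walk i x * (ln (walk j x) - ln (walk k x))\<bar> \<le> 1 * (- ln (e ^ j) + - ln (e ^ k))"
    if "x \<in> space M" for i j k x
    using ln_bound[OF that, of j] ln_bound[OF that, of k] abs_walk_le[OF that, of i]
    unfolding abs_mult by (intro mult_mono) auto
  have density_pos: "0 < path_density k" for k
  proof -
    have "e ^ k \<le> path_density k" unfolding path_density_def
      using walk_ge_power[OF e] by (intro integral_ge_const integrable_walk) auto
    then show ?thesis using e(1) by (meson less_le_trans zero_less_power)
  qed
  \<comment> \<open>Divided by \<open>path_density (i + j)\<close>, this is the mean of
    \<open>ln (walk j x) - ln (walk i x)\<close> at the vertex \<open>x\<close> that a weighted
    random walk of \<open>i + j\<close> edges reaches after \<open>i\<close> steps.\<close>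
  define D where "D i j = (\<integral>x. walk i x * walk j x * (ln (walk j x) - ln (walk i x)) \<partial>M)" for i j
  have D_antisym: "D j i = - D i j" for i j
    unfolding D_def by (subst integral_minus[symmetric])
      (auto intro!: Bochner_Integration.integral_cong simp: algebra_simps)
  \<comment> \<open>Jensen's inequality for the law of the edge that a random walk of length \<open>i + j + 1\<close> traverses
    after \<open>i\<close> steps.\<close>
  have step: "D i (Suc j) + D j (Suc i)
      \<le> path_density (i + Suc j) * ln (path_density (i + Suc j + 2) / path_density (i + Suc j))"
    for i j
  proof -
    \<comment> \<open>\<open>c\<close> is the mean of the ratio \<open>R\<close> below under this
      edge law: multiplying by \<open>R\<close> turns the weight \<open>walk i * W * walk j\<close>
      into \<open>walk (Suc j) * W * walk (Suc i)\<close>, which belongs to walks with two more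
      edges.\<close>
    define c where "c = path_density (i + Suc j + 2) / path_density (i + Suc j)"
    have c: "0 < c" unfolding c_def using density_pos by simp
    define f g where "f = (\<lambda>x. walk i x * (ln (walk (Suc j) x) - ln (walk i x)))"
      and "g = (\<lambda>x. walk j x * (ln (walk (Suc i) x) - ln (walk j x)))"
    have fg [measurable]: "f \<in> borel_measurable M" "g \<in> borel_measurable M"
      unfolding f_def g_def by measurable
    note bounds = mult_ln_bound[of _ i "Suc j" i, folded fun_cong[OF f_def]]
      mult_ln_bound[of _ j "Suc i" j, folded fun_cong[OF g_def]]
    note s1 = integral_form_swap[OF fg(1) measurable_walk bounds(1) abs_walk_le, of j]
    note s2 = integral_form_swap[OF measurable_walk fg(2) abs_walk_le bounds(2), of i]
    note s3 = integral_form_swap[OF measurable_walk measurable_walk abs_walk_le abs_walk_le]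
    have "D i (Suc j) + D j (Suc i)
        = (\<integral>p. f (fst p) * W (fst p) (snd p) * walk j (snd p)
            + walk i (fst p) * W (fst p) (snd p) * g (snd p) \<partial>(M \<Otimes>\<^sub>M M))"
    proof -
      have "D i (Suc j) = (\<integral>p. f (fst p) * W (fst p) (snd p) * walk j (snd p) \<partial>(M \<Otimes>\<^sub>M M))"
        by (subst s1(1)) (simp_all add: D_def f_def mult_ac)
      moreover have "D j (Suc i) = (\<integral>p. walk i (fst p) * W (fst p) (snd p) * g (snd p) \<partial>(M \<Otimes>\<^sub>M M))"
        by (subst s2(2)) (simp_all add: D_def g_def mult_ac)
      ultimately show ?thesis using Bochner_Integration.integral_add[OF s1(3) s2(3)] by simp
    qed
    \<comment> \<open>Jensen is carried out pointwise: the tangent of \<open>ln\<close> at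
      \<open>c\<close> gives \<open>ln R \<le> R / c + ln c - 1\<close>, which is multiplied by the
      edge weight and integrated.\<close>
    also have "\<dots> \<le> (\<integral>p. walk (Suc j) (fst p) * W (fst p) (snd p) * walk (Suc i) (snd p) / c
            + (ln c - 1) * (walk i (fst p) * W (fst p) (snd p) * walk j (snd p)) \<partial>(M \<Otimes>\<^sub>M M))"
    proof (intro integral_mono Bochner_Integration.integrable_add s1(3) s2(3) s3(3)
        integrable_mult_right integrable_divide)
      fix p assume "p \<in> space (M \<Otimes>\<^sub>M M)"
      then obtain y z where p: "p = (y, z)" "y \<in> space M" "z \<in> space M"
        by (auto simp: space_pair_measure)
      define R where "R = walk (Suc j) y * walk (Suc i) z / (walk i y * walk j z)"
      define E where "E = walk i y * W y z * walk j z"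
      note walk.simps(2) [simp del]
      note [simp] = pos[OF p(2)] pos[OF p(3)]
      note [simp] = pos[OF p(2), THEN less_imp_neq, THEN not_sym] pos[OF p(3), THEN less_imp_neq, THEN not_sym]
      have R: "0 < R" unfolding R_def by simp
      have E: "0 \<le> E" using W_nonneg[OF p(2,3)] less_imp_le[OF pos[OF p(2)]] less_imp_le[OF pos[OF p(3)]]
        unfolding E_def by (intro mult_nonneg_nonneg)
      have lnR: "ln R = (ln (walk (Suc j) y) - ln (walk i y)) + (ln (walk (Suc i) z) - ln (walk j z))"
        unfolding R_def by (subst ln_div) (auto simp: ln_mult)
      have "ln (R / c) \<le> R / c - 1" using R c by (intro ln_le_minus_one) simp
      then have "ln R \<le> R / c - 1 + ln c" using R c by (simp add: ln_div)
      then have "E * ln R \<le> E * (R / c - 1 + ln c)" using E by (intro mult_left_mono)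
      also have "E * R = walk (Suc j) y * W y z * walk (Suc i) z"
        unfolding E_def R_def by simp
      then have "E * (R / c - 1 + ln c) = walk (Suc j) y * W y z * walk (Suc i) z / c + (ln c - 1) * E"
        by (simp add: algebra_simps)
      finally show "f (fst p) * W (fst p) (snd p) * walk j (snd p)
            + walk i (fst p) * W (fst p) (snd p) * g (snd p)
          \<le> walk (Suc j) (fst p) * W (fst p) (snd p) * walk (Suc i) (snd p) / c
            + (ln c - 1) * (walk i (fst p) * W (fst p) (snd p) * walk j (snd p))"
        unfolding E_def lnR f_def g_def p(1) by (simp add: algebra_simps)
    qed
    also have "\<dots> = path_density (i + Suc j + 2) / c + (ln c - 1) * path_density (i + Suc j)"
    proof -
      have "(\<integral>p. walk (Suc j) (fst p) * W (fst p) (snd p) * walk (Suc i) (snd p) \<partial>(M \<Otimes>\<^sub>M M))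
          = path_density (i + Suc j + 2)"
        by (subst s3(1)) (simp_all add: integral_walk_mult add.commute flip: walk.simps(2))
      moreover have "(\<integral>p. walk i (fst p) * W (fst p) (snd p) * walk j (snd p) \<partial>(M \<Otimes>\<^sub>M M))
          = path_density (i + Suc j)"
        by (subst s3(1)) (simp_all add: integral_walk_mult flip: walk.simps(2))
      ultimately show ?thesis
        using s3(3)[of "Suc j" "Suc i"] s3(3)[of i j] by (simp del: walk.simps)
    qed
    also have "path_density (i + Suc j + 2) / c = path_density (i + Suc j)"
      unfolding c_def using density_pos[of "i + Suc j + 2"] by simp
    finally show ?thesis unfolding c_def by (simp add: algebra_simps)
  qed
  let ?w = "path_density m" and ?v = "path_density (m + 2)"
  \<comment> \<open>The term from the end vertices. Jensen for \<open>u * ln u\<close> bounds it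
    from below, again pointwise, through \<open>u * ln (?w / u) \<le> ?w - u\<close>.\<close>
  have "D 0 m = (\<integral>x. walk m x * ln (walk m x) \<partial>M)" by (simp add: D_def)
  also have "\<dots> \<ge> (\<integral>x. (ln ?w + 1) * walk m x - ?w \<partial>M)"
  proof (rule integral_mono)
    show "integrable M (\<lambda>x. walk m x * ln (walk m x))"
      using mult_ln_bound[of _ m m 0] by (intro integrable_bounded) auto
    show "integrable M (\<lambda>x. (ln ?w + 1) * walk m x - ?w)" using integrable_walk by simp
    fix x assume x: "x \<in> space M"
    have "ln (?w / walk m x) \<le> ?w / walk m x - 1"
      using pos[OF x] density_pos by (intro ln_le_minus_one) simp
    then have "walk m x * (ln ?w - ln (walk m x)) \<le> walk m x * (?w / walk m x - 1)"
      using pos[OF x, of m] density_pos[of m] by (intro mult_left_mono) (auto simp: ln_div)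
    then show "(ln ?w + 1) * walk m x - ?w \<le> walk m x * ln (walk m x)"
      using pos[OF x, of m] by (simp add: algebra_simps)
  qed
  also have "(\<integral>x. (ln ?w + 1) * walk m x - ?w \<partial>M) = ?w * ln ?w"
    using integrable_walk[of m] by (simp add: prob_space algebra_simps flip: path_density_def)
  finally have D0: "?w * ln ?w \<le> D 0 m" .
  \<comment> \<open>Reversing the walk flips the sign of every summand, so the full sum vanishes.
    Leaving out its last term, \<open>D m 0 = - D 0 m\<close>, leaves \<open>D 0 m\<close>.\<close>
  have "(\<Sum>i\<le>m. D i (m - i)) = (\<Sum>i\<le>m. D (m - i) i)"
    by (subst sum.nat_diff_reindex[of _ "Suc m", simplified lessThan_Suc_atMost, symmetric]) auto
  also have "\<dots> = - (\<Sum>i\<le>m. D i (m - i))" by (subst D_antisym) (simp add: sum_negf)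
  finally have "(\<Sum>i\<le>m. D i (m - i)) = 0" by simp
  then have telescope: "(\<Sum>i<m. D i (m - i)) = D 0 m"
    using D_antisym[of m 0] by (simp flip: lessThan_Suc_atMost)
  \<comment> \<open>Summed over the \<open>m\<close> edges, the two terms of \<open>step\<close>
    give the same sum, the second time in reverse order; hence the factor 2.\<close>
  have "2 * (?w * ln ?w) \<le> (\<Sum>i<m. D i (m - i)) + (\<Sum>i<m. D (m - Suc i) (m - (m - Suc i)))"
    unfolding sum.nat_diff_reindex[of "\<lambda>i. D i (m - i)"] telescope using D0 by simp
  also have "\<dots> = (\<Sum>i<m. D i (Suc (m - Suc i)) + D (m - Suc i) (Suc i))"
    by (auto simp: sum.distrib[symmetric] Suc_diff_Suc intro!: sum.cong)
  also have "\<dots> \<le> (\<Sum>i<m. ?w * ln (?v / ?w))"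
  proof (rule sum_mono)
    fix i assume "i \<in> {..<m}"
    then show "D i (Suc (m - Suc i)) + D (m - Suc i) (Suc i) \<le> ?w * ln (?v / ?w)"
      using step[of i "m - Suc i"] by (simp add: Suc_diff_Suc)
  qed
  also have "\<dots> = ?w * (m * (ln ?v - ln ?w))"
    using density_pos[of m] density_pos[of "m + 2"] by (simp add: ln_div)
  finally have "?w * (2 * ln ?w) \<le> ?w * (m * (ln ?v - ln ?w))" by (simp add: mult_ac)
  then have "2 * ln ?w \<le> m * (ln ?v - ln ?w)" using density_pos[of m] by (rule mult_left_le_imp_le)
  then have "(m + 2) * ln ?w \<le> m * ln ?v" by (simp add: algebra_simps)
  then have "ln (?w ^ (m + 2)) \<le> ln (?v ^ m)"
    using density_pos[of m] density_pos[of "m + 2"] by (simp only: ln_realpow)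
  then show ?thesis using density_pos[of m] density_pos[of "m + 2"] by simp
qed

text \<open>Mixing \<open>W\<close> with the constant kernel 1 makes it at least
  \<open>\<epsilon> n\<close>. By dominated convergence the path densities of the mixtures tend to
  those of \<open>W\<close>, and the non-strict inequality passes to the limit.\<close>

lemma density_step: "path_density m ^ (m + 2) \<le> path_density (m + 2) ^ m"
proof -
  define \<epsilon> where "\<epsilon> n = inverse (real (Suc n))" for n
  define V where "V n x y = W x y + \<epsilon> n * (1 - W x y)" for n x y
  have \<epsilon>: "0 < \<epsilon> n" "\<epsilon> n \<le> 1" for n by (auto simp: \<epsilon>_def divide_simps)
  have V_ge: "\<epsilon> n \<le> V n x y" and V_le: "V n x y \<le> 1" if "x \<in> space M" "y \<in> space M" for n x y
  proof -
    have "0 \<le> (1 - \<epsilon> n) * W x y" "0 \<le> (1 - \<epsilon> n) * (1 - W x y)"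
      using \<epsilon>[of n] W_nonneg[OF that] W_le_1[OF that] by simp_all
    then show "\<epsilon> n \<le> V n x y" "V n x y \<le> 1" by (simp_all add: V_def algebra_simps)
  qed
  have K: "symmetric_kernel M (V n)" for n
  proof
    show "case_prod (V n) \<in> borel_measurable (M \<Otimes>\<^sub>M M)" unfolding V_def by measurable
    show "0 \<le> V n x y" "V n x y \<le> 1" "V n x y = V n y x" if "x \<in> space M" "y \<in> space M" for x y
      using V_ge[OF that, of n] V_le[OF that, of n] \<epsilon>(1)[of n] W_sym[OF that] by (auto simp: V_def)
  qed
  have walk_lim: "(\<lambda>n. symmetric_kernel.walk M (V n) k x) \<longlonglongrightarrow> walk k x" if "x \<in> space M" for k x
    using that
  proof (induction k arbitrary: x)
    case (Suc k)
    have V_lim: "(\<lambda>n. V n x y) \<longlonglongrightarrow> W x y" for y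
      using tendsto_add[OF tendsto_const tendsto_mult[OF LIMSEQ_inverse_real_of_nat tendsto_const]]
      by (simp add: V_def \<epsilon>_def)
    have [measurable]: "W x \<in> borel_measurable M" using Suc.prems by measurable
    have [measurable]: "V n x \<in> borel_measurable M" for n unfolding V_def by measurable
    have [measurable]: "symmetric_kernel.walk M (V n) k \<in> borel_measurable M" for n
      by (rule symmetric_kernel.measurable_walk[OF K])
    have "(\<lambda>n. \<integral>y. V n x y * symmetric_kernel.walk M (V n) k y \<partial>M) \<longlonglongrightarrow> (\<integral>y. W x y * walk k y \<partial>M)"
    proof (rule integral_dominated_convergence[where w = "\<lambda>_. 1"])
      show "AE y in M. (\<lambda>n. V n x y * symmetric_kernel.walk M (V n) k y) \<longlonglongrightarrow> W x y * walk k y"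
        by (intro AE_I2 tendsto_mult V_lim Suc.IH)
      show "AE y in M. norm (V n x y * symmetric_kernel.walk M (V n) k y) \<le> 1" for n
      proof (rule AE_I2)
        fix y assume y: "y \<in> space M"
        show "norm (V n x y * symmetric_kernel.walk M (V n) k y) \<le> 1"
          using symmetric_kernel.abs_W_le[OF K Suc.prems y, of n]
            symmetric_kernel.abs_walk_le[OF K y, of n k] by (simp add: abs_mult mult_le_one)
      qed
    qed auto
    then show ?case by (simp add: symmetric_kernel.walk.simps[OF K])
  qed (simp add: symmetric_kernel.walk.simps[OF K])
  have lim: "(\<lambda>n. symmetric_kernel.path_density M (V n) k) \<longlonglongrightarrow> path_density k" for k
    unfolding path_density_def symmetric_kernel.path_density_def[OF K]
  proof (rule integral_dominated_convergence[where w = "\<lambda>_. 1"])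
    show "AE x in M. norm (symmetric_kernel.walk M (V n) k x) \<le> 1" for n
      using symmetric_kernel.abs_walk_le[OF K] by auto
    show "symmetric_kernel.walk M (V n) k \<in> borel_measurable M" for n
      by (rule symmetric_kernel.measurable_walk[OF K])
  qed (auto intro: walk_lim)
  have "symmetric_kernel.path_density M (V n) m ^ (m + 2)
      \<le> symmetric_kernel.path_density M (V n) (m + 2) ^ m" for n
    by (rule symmetric_kernel.density_step_of_positive[OF K \<epsilon>(1)]) (rule V_ge)
  then show ?thesis
    by (intro LIMSEQ_le[OF tendsto_power[OF lim] tendsto_power[OF lim]]) auto
qed

end

section \<open>Linear inequalities between the logarithms of path densities\<close>

text \<open>The average slopes to the left and to the right of \<open>i + s\<close> are both
  compared with the increment \<open>d (i + s)\<close>.\<close>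

lemma convex_sequence_chord:
  fixes c :: "nat \<Rightarrow> real"
  assumes convex: "\<And>j. 2 * c (Suc j) \<le> c j + c (Suc (Suc j))"
  shows "real (s + t) * c (i + s) \<le> real t * c i + real s * c (i + s + t)"
proof -
  define d where "d j = c (Suc j) - c j" for j
  have "mono d"
    unfolding mono_iff_le_Suc d_def using convex by (simp add: algebra_simps)
  then have mono: "d i \<le> d j" if "i \<le> j" for i j using that by (rule monoD)
  have right: "real t * d j \<le> c (j + t) - c j" for j t
  proof (induction t)
    case (Suc t)
    then show ?case using mono[of j "j + t"] by (simp add: d_def algebra_simps)
  qed simp
  have left: "c (i + s) - c i \<le> real s * d (i + s)" for s
  proof (induction s)
    case (Suc s)
    have "real (Suc s) * d (i + s) \<le> real (Suc s) * d (i + Suc s)"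
      by (intro mult_left_mono mono) auto
    then show ?case using Suc by (simp add: d_def algebra_simps)
  qed simp
  have "real t * (c (i + s) - c i) \<le> real t * (real s * d (i + s))"
    by (intro mult_left_mono left) simp
  moreover have "real s * (real t * d (i + s)) \<le> real s * (c (i + s + t) - c (i + s))"
    by (intro mult_left_mono right) simp
  ultimately show ?thesis by (simp add: algebra_simps)
qed

text \<open>\<open>l k\<close> stands for \<open>ln (path_density k)\<close>. Every upper bound on
  the exponent is a linear consequence of these properties.\<close>

locale log_path_profile =
  fixes l :: "nat \<Rightarrow> real"
  assumes l_0: "l 0 = 0"
    and midpoint: "2 * l (a + b) \<le> l (2 * a) + l (2 * b)"
    and delete_edge: "l (a + Suc b) \<le> l a + l b"
    and add_two: "real (k + 2) * l k \<le> real k * l (k + 2)"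
begin

lemma decreasing: "l (Suc k) \<le> l k"
  using delete_edge[of k 0] l_0 by simp

text \<open>\<open>midpoint\<close> has even indices on its right-hand side, so it yields convexity
  between direct neighbours only at odd \<open>k\<close>.\<close>

lemma odd_midpoint:
  assumes "odd k"
  shows "2 * l k \<le> l (k - 1) + l (k + 1)"
proof -
  obtain j where "k = 2 * j + 1" using assms by (rule oddE)
  then have "k = j + Suc j" "k - 1 = 2 * j" "k + 1 = 2 * Suc j" by simp_all
  then show ?thesis using midpoint[of j "Suc j"] by metis
qed

text \<open>For positive \<open>k\<close>, \<open>add_two\<close> says that \<open>l k / k\<close>
  does not decrease when \<open>k\<close> grows by 2; this is iterated \<open>j\<close>
  times.\<close>

lemma upper_same_parity:
  assumes "m \<ge> 1"
  shows "real (m + 2 * j) * l m \<le> real m * l (m + 2 * j)"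
proof (induction j)
  case (Suc j)
  let ?k = "m + 2 * j"
  have "real ?k * (real (?k + 2) * l m) = real (?k + 2) * (real ?k * l m)" by simp
  also have "\<dots> \<le> real (?k + 2) * (real m * l ?k)" using Suc by (intro mult_left_mono) auto
  also have "\<dots> = real m * (real (?k + 2) * l ?k)" by simp
  also have "\<dots> \<le> real m * (real ?k * l (?k + 2))" by (intro mult_left_mono add_two) simp
  also have "\<dots> = real ?k * (real m * l (?k + 2))" by simp
  finally have "real (?k + 2) * l m \<le> real m * l (?k + 2)"
    using assms by (subst (asm) mult_le_cancel_left_pos) auto
  then show ?case by (simp add: algebra_simps)
qed simp

text \<open>If the parities differ, then \<open>m\<close> is odd and \<open>n\<close> even, and a
  single step from \<open>m\<close> to \<open>m + 1\<close> reduces to equal parities.\<close>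

lemma upper_longer:
  assumes "m \<ge> 1" "m < n" "even n \<or> odd m"
  shows "real n * l m \<le> real m * l n"
proof (cases "even (n - m)")
  case True
  then obtain j where "n - m = 2 * j" by (rule evenE)
  then have "n = m + 2 * j" using assms(2) by simp
  then show ?thesis using upper_same_parity[OF assms(1)] by simp
next
  case False
  then have m: "odd m" and "even (n - Suc m)" using assms by auto
  then obtain j where "n - Suc m = 2 * j" by (meson evenE)
  then have n: "n = Suc m + 2 * j" using assms(2) by simp
  \<comment> \<open>Eliminating \<open>l (m - 1)\<close> between \<open>add_two\<close> and
    \<open>odd_midpoint\<close> gives the step from \<open>m\<close> to
    \<open>m + 1\<close>.\<close>
  have "real (m + 1) * l (m - 1) \<le> real (m - 1) * l (m + 1)"
    using add_two[of "m - 1"] assms(1) by simp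
  moreover have "real (m + 1) * (2 * l m) \<le> real (m + 1) * (l (m - 1) + l (m + 1))"
    by (intro mult_left_mono odd_midpoint m) simp
  ultimately have *: "real (Suc m) * l m \<le> real m * l (Suc m)"
    using assms(1) by (simp add: of_nat_diff algebra_simps)
  have "real (Suc m) * (real n * l m) = real n * (real (Suc m) * l m)" by simp
  also have "\<dots> \<le> real n * (real m * l (Suc m))" by (intro mult_left_mono *) simp
  also have "\<dots> = real m * (real n * l (Suc m))" by simp
  also have "\<dots> \<le> real m * (real (Suc m) * l n)"
    using upper_same_parity[of "Suc m" j] n by (intro mult_left_mono) auto
  also have "\<dots> = real (Suc m) * (real m * l n)" by simp
  finally show ?thesis by (subst (asm) mult_le_cancel_left_pos) auto
qed

text \<open>A short \<open>P_m\<close> is compared with the even length \<open>n + 1\<close>. From a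
  longer one a copy of \<open>P_n\<close> is split off, which lowers \<open>m\<close> by the even
  number \<open>n + 1\<close>; the remainder stays even and may reach 0.\<close>

lemma upper_odd_even:
  assumes "odd n" "even m"
  shows "real (n + 1) * l m \<le> real m * l n"
  using assms(2)
proof (induction m rule: less_induct)
  case (less m)
  consider "m = 0" | "1 \<le> m" "m < n + 1" | "n + 1 \<le> m" by linarith
  then show ?case
  proof cases
    case 1
    then show ?thesis by (simp add: l_0)
  next
    case 2
    then have "real (n + 1) * l m \<le> real m * l (n + 1)"
      using assms by (intro upper_longer) auto
    also have "\<dots> \<le> real m * l n" using decreasing[of n] by (intro mult_left_mono) auto
    finally show ?thesis .
  next
    case 3
    then obtain j where m: "m = n + Suc j" using less_imp_Suc_add[of n m] by auto
    have "real (n + 1) * l m \<le> real (n + 1) * (l n + l j)"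
      unfolding m by (intro mult_left_mono delete_edge) simp
    moreover have "real (n + 1) * l j \<le> real j * l n"
      using less.prems assms(1) m by (intro less.IH) auto
    ultimately show ?thesis by (simp add: m algebra_simps)
  qed
qed

lemma upper_shorter_even:
  assumes "even n" "n \<le> m"
  shows "real (n + 1) * l m \<le> real (m + 1) * l n"
  using assms(2)
proof (induction m rule: less_induct)
  case (less m)
  obtain N where N: "n = 2 * N" using assms(1) by (rule evenE)
  \<comment> \<open>Three disjoint copies of \<open>P_n\<close> span \<open>P_{3n+2}\<close>, so at \<open>3n+2\<close> the sequence \<open>l\<close> is below the line
    through \<open>(-1, 0)\<close> and \<open>(n, l n)\<close>; convexity along the even indices does the rest.\<close>
  have "l (n + Suc (n + Suc n)) \<le> 3 * l n"
    using delete_edge[of n "n + Suc n"] delete_edge[of n n] by simp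
  then have three: "l (2 * (N + (2 * N + 1))) \<le> 3 * l n" by (simp add: N)
  \<comment> \<open>In halved indices the chord runs from \<open>N\<close> to
    \<open>N + (n + 1)\<close>, that is, from length \<open>n\<close> to
    \<open>3 * n + 2\<close>.\<close>
  have even_case: "real (n + 1) * l (2 * (N + s)) \<le> real (2 * (N + s) + 1) * l n" if "s \<le> n + 1" for s
  proof -
    have "real (s + (n + 1 - s)) * l (2 * (N + s))
        \<le> real (n + 1 - s) * l (2 * N) + real s * l (2 * (N + s + (n + 1 - s)))"
    proof (rule convex_sequence_chord[of "\<lambda>j. l (2 * j)"])
      fix j
      have "j + Suc (Suc j) = 2 * Suc j" by simp
      then show "2 * l (2 * Suc j) \<le> l (2 * j) + l (2 * Suc (Suc j))"
        using midpoint[of j "Suc (Suc j)"] by (simp only:)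
    qed
    also have "\<dots> \<le> real (n + 1 - s) * l (2 * N) + real s * (3 * l n)"
      using three that by (intro add_left_mono mult_left_mono) (auto simp: N)
    also have "\<dots> = real (2 * (N + s) + 1) * l n"
      using that by (simp add: N of_nat_diff algebra_simps)
    finally show ?thesis using that by simp
  qed
  \<comment> \<open>Up to \<open>2 * n\<close>, an even \<open>m\<close>, or both neighbours of an
    odd one, are within reach of \<open>even_case\<close>. Beyond that, splitting off
    \<open>P_n\<close> leaves length at least \<open>n\<close>, as the induction requires.\<close>
  show ?case
  proof (cases "m \<le> 2 * n")
    case True
    show ?thesis
    proof (cases "even m")
      case True
      then obtain k where k: "m = 2 * k" by (rule evenE)
      then have "N \<le> k" using less.prems N by simp
      then obtain s where "k = N + s" using le_Suc_ex by blast
      with k have "m = 2 * (N + s)" by simp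
      then show ?thesis using even_case[of s] \<open>m \<le> 2 * n\<close> N by simp
    next
      case False
      then obtain k where k: "m = 2 * k + 1" by (rule oddE)
      then have "N \<le> k" using less.prems N by simp
      then obtain s where s: "k = N + s" using le_Suc_ex by blast
      have "real (n + 1) * (2 * l m) \<le> real (n + 1) * (l (m - 1) + l (m + 1))"
        using False by (intro mult_left_mono odd_midpoint) auto
      moreover have "m - 1 = 2 * (N + s)" "m + 1 = 2 * (N + Suc s)" by (simp_all add: k s)
      ultimately show ?thesis
        using even_case[of s] even_case[of "Suc s"] \<open>m \<le> 2 * n\<close> N k s by (simp add: algebra_simps)
    qed
  next
    case False
    then obtain j where m: "m = n + Suc j" using less_imp_Suc_add[of n m] by auto
    then have "n \<le> j" using False by simp
    have "real (n + 1) * l m \<le> real (n + 1) * (l n + l j)"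
      unfolding m by (intro mult_left_mono delete_edge) simp
    moreover have "real (n + 1) * l j \<le> real (j + 1) * l n"
      using m \<open>n \<le> j\<close> by (intro less.IH) auto
    ultimately show ?thesis by (simp add: m algebra_simps)
  qed
qed

text \<open>The \<open>m + 1\<close> vertices of \<open>P_m\<close> are cut into consecutive blocks
  of \<open>n + 1\<close>, each spanning a \<open>P_n\<close>; the induction removes one block at a
  time.\<close>

lemma upper_dvd:
  assumes "(n + 1) dvd (m + 1)"
  shows "real (n + 1) * l m \<le> real (m + 1) * l n"
  using assms
proof (induction m rule: less_induct)
  case (less m)
  show ?case
  proof (cases "m \<le> n")
    case True
    then show ?thesis using dvd_imp_le[OF less.prems] by simp
  next
    case False
    then obtain j where m: "m = n + Suc j" using less_imp_Suc_add[of n m] by auto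
    then have "m + 1 = (n + 1) + (j + 1)" by simp
    then have "(n + 1) dvd (j + 1)" using less.prems by (metis dvd_add_triv_left_iff)
    then have "real (n + 1) * l j \<le> real (j + 1) * l n" using m by (intro less.IH) auto
    moreover have "real (n + 1) * l m \<le> real (n + 1) * (l n + l j)"
      unfolding m by (intro mult_left_mono delete_edge) simp
    ultimately show ?thesis by (simp add: m algebra_simps)
  qed
qed

end

section \<open>Homomorphism densities as walk densities\<close>

text \<open>Serves the integrand of \<open>hom_density\<close>, which is only known to agree almost
  everywhere with a function measurable for the product.\<close>

lemma borel_measurable_completion_AE:
  fixes f g :: "'a \<Rightarrow> real"
  assumes [measurable]: "g \<in> borel_measurable M" and "AE x in M. f x = g x"
  shows "f \<in> borel_measurable (completion M)"
proof -
  obtain N where N: "N \<in> null_sets M" "{x \<in> space M. f x \<noteq> g x} \<subseteq> N"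
    using assms(2) by (auto elim!: AE_E)
  show ?thesis
  proof (rule measurableI)
    fix A :: "real set" assume A [measurable]: "A \<in> sets borel"
    have "f -` A \<inter> N \<inter> space M \<in> sets (completion M)"
      by (rule sets_completionI_sub[OF N(1)]) auto
    moreover have "g -` A \<inter> space M - N \<in> sets (completion M)"
      using N(1) by (intro sets_completionI_sets sets.Diff measurable_sets[OF assms(1) A]) auto
    moreover have "f -` A \<inter> space (completion M) = (f -` A \<inter> N \<inter> space M) \<union> (g -` A \<inter> space M - N)"
      using N(2) by auto
    ultimately show "f -` A \<inter> space (completion M) \<in> sets (completion M)" by simp
  qed simp
qed

text \<open>Two distinct coordinates have the product measure as joint law, so null sets of pairs
  pull back to null sets of the whole product.\<close>

lemma (in product_prob_space) AE_PiM_pair: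
  assumes "i \<in> I" "j \<in> I" "i \<noteq> j" and AE: "AE p in M i \<Otimes>\<^sub>M M j. Q p"
  shows "AE x in PiM I M. Q (x i, x j)"
proof -
  have meas: "(\<lambda>x. (x i, x j)) \<in> PiM I M \<rightarrow>\<^sub>M M i \<Otimes>\<^sub>M M j"
    using assms(1,2) by measurable
  have "M i \<Otimes>\<^sub>M M j = distr (PiM I M) (M i \<Otimes>\<^sub>M M j) (\<lambda>x. (x i, x j))"
  proof (rule pair_measure_eqI)
    fix A B assume A: "A \<in> sets (M i)" and B: "B \<in> sets (M j)"
    have "emeasure (distr (PiM I M) (M i \<Otimes>\<^sub>M M j) (\<lambda>x. (x i, x j))) (A \<times> B)
        = emeasure (PiM I M) ((\<lambda>x. (x i, x j)) -` (A \<times> B) \<inter> space (PiM I M))"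
      using A B by (intro emeasure_distr meas) auto
    also have "(\<lambda>x. (x i, x j)) -` (A \<times> B) \<inter> space (PiM I M)
        = {x \<in> space (PiM I M). \<forall>k\<in>{i, j}. x k \<in> (if k = i then A else B)}"
      using assms(3) by auto
    also have "emeasure (PiM I M) \<dots> = emeasure (M i) A * emeasure (M j) B"
      using assms(1-3) A B by (subst emeasure_PiM_Collect) auto
    finally show "emeasure (M i) A * emeasure (M j) B
        = emeasure (distr (PiM I M) (M i \<Otimes>\<^sub>M M j) (\<lambda>x. (x i, x j))) (A \<times> B)" ..
  qed (auto intro: M.sigma_finite_measure_axioms)
  then show ?thesis using AE_distrD[OF meas] AE by metis
qed

lemma prod_path_graph_edges:
  fixes W :: "'a \<Rightarrow> 'a \<Rightarrow> real"
  shows "(\<Prod>e\<in>edges (path_graph k). W (x (Min e)) (x (Max e))) = (\<Prod>i<k. W (x i) (x (Suc i)))"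
proof -
  have "edges (path_graph k) = (\<lambda>i. {i, Suc i}) ` {..<k}"
    by (auto simp: path_graph_def)
  moreover have "inj_on (\<lambda>i. {i, Suc i}) {..<k}"
    by (auto simp: inj_on_def doubleton_eq_iff)
  ultimately show ?thesis by (simp add: prod.reindex)
qed

context symmetric_kernel
begin

lemma measurable_path_product [measurable]:
  "(\<lambda>x. \<Prod>i<k. W (x i) (x (Suc i))) \<in> borel_measurable (PiM {0..k} (\<lambda>_. M))"
proof (rule borel_measurable_prod)
  fix i assume "i \<in> {..<k}"
  then have [measurable]: "i \<in> {0..k}" "Suc i \<in> {0..k}" by auto
  show "(\<lambda>x. W (x i) (x (Suc i))) \<in> borel_measurable (PiM {0..k} (\<lambda>_. M))"
    by measurable
qed

text \<open>The test function \<open>f\<close> at the last vertex carries the induction: integrating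
  that vertex out replaces \<open>f\<close> by its image \<open>g\<close> under the kernel operator,
  and self-adjointness returns this step to the walk.\<close>

lemma integral_path_product:
  fixes f :: "'a \<Rightarrow> real"
  assumes "f \<in> borel_measurable M" "\<And>x. x \<in> space M \<Longrightarrow> \<bar>f x\<bar> \<le> c"
  shows "(\<integral>x. (\<Prod>i<k. W (x i) (x (Suc i))) * f (x k) \<partial>PiM {0..k} (\<lambda>_. M)) = (\<integral>x. walk k x * f x \<partial>M)"
  using assms
proof (induction k arbitrary: f)
  case 0
  interpret P: product_sigma_finite "\<lambda>_::nat. M" ..
  show ?case using P.product_integral_singleton[of f 0] 0 by simp
next
  case (Suc k)
  interpret P: product_sigma_finite "\<lambda>_::nat. M" ..
  interpret Q: prob_space "PiM {0..Suc k} (\<lambda>_. M)" by (intro prob_space_PiM prob_space_axioms)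
  note [measurable] = Suc.prems(1)
  define g where "g x = (\<integral>y. W x y * f y \<partial>M)" for x
  have g_meas: "g \<in> borel_measurable M" unfolding g_def by measurable
  have c: "0 \<le> c" using Suc.prems(2) not_empty by (meson abs_ge_zero ex_in_conv order_trans)
  have g_bound: "\<bar>g x\<bar> \<le> c" if x: "x \<in> space M" for x
  proof -
    have [measurable]: "W x \<in> borel_measurable M" using x by measurable
    have Wf: "\<bar>W x y * f y\<bar> \<le> c" if "y \<in> space M" for y
      using mult_mono[OF abs_W_le[OF x that] Suc.prems(2)[OF that]] by (simp add: abs_mult)
    have "\<bar>g x\<bar> \<le> (\<integral>y. \<bar>W x y * f y\<bar> \<partial>M)" unfolding g_def by (rule integral_abs_bound)
    also have "\<dots> \<le> c" using Wf by (intro integral_le_const integrable_bounded[of _ c]) auto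
    finally show ?thesis .
  qed
  have space: "x i \<in> space M" if "x \<in> space (PiM {0..l} (\<lambda>_. M))" "i \<le> l" for x and i l :: nat
    using that by (auto simp: space_PiM)
  have set_eq: "{0..Suc k} = insert (Suc k) {0..k}" by (rule atLeastAtMostSuc_conv) simp
  have "Suc k \<in> {0..Suc k}" by simp
  note [measurable] = this
  have integrable: "integrable (PiM {0..Suc k} (\<lambda>_. M))
      (\<lambda>x. (\<Prod>i<Suc k. W (x i) (x (Suc i))) * f (x (Suc k)))"
  proof (rule Q.integrable_const_bound[of _ c])
    show "AE x in PiM {0..Suc k} (\<lambda>_. M). norm ((\<Prod>i<Suc k. W (x i) (x (Suc i))) * f (x (Suc k))) \<le> c"
    proof (rule AE_I2)
      fix x assume x: "x \<in> space (PiM {0..Suc k} (\<lambda>_. M))"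
      have "\<bar>\<Prod>i<Suc k. W (x i) (x (Suc i))\<bar> \<le> 1"
        unfolding abs_prod by (intro prod_le_1) (use x in \<open>auto intro!: abs_W_le space\<close>)
      then show "norm ((\<Prod>i<Suc k. W (x i) (x (Suc i))) * f (x (Suc k))) \<le> c"
        using mult_mono[OF _ Suc.prems(2)[OF space[OF x order_refl]], of _ 1] c by (simp add: abs_mult)
    qed
  qed measurable
  have "(\<integral>x. (\<Prod>i<Suc k. W (x i) (x (Suc i))) * f (x (Suc k)) \<partial>PiM {0..Suc k} (\<lambda>_. M))
      = (\<integral>x. (\<integral>y. (\<Prod>i<Suc k. W ((x(Suc k := y)) i) ((x(Suc k := y)) (Suc i)))
            * f ((x(Suc k := y)) (Suc k)) \<partial>M) \<partial>PiM {0..k} (\<lambda>_. M))"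
    using integrable unfolding set_eq by (intro P.product_integral_insert) auto
  also have "\<dots> = (\<integral>x. (\<Prod>i<k. W (x i) (x (Suc i))) * g (x k) \<partial>PiM {0..k} (\<lambda>_. M))"
  proof (rule Bochner_Integration.integral_cong[OF refl])
    fix x :: "nat \<Rightarrow> 'a"
    have "(\<Prod>i<k. W ((x(Suc k := y)) i) ((x(Suc k := y)) (Suc i))) = (\<Prod>i<k. W (x i) (x (Suc i)))" for y
      by (intro prod.cong) auto
    then show "(\<integral>y. (\<Prod>i<Suc k. W ((x(Suc k := y)) i) ((x(Suc k := y)) (Suc i)))
            * f ((x(Suc k := y)) (Suc k)) \<partial>M) = (\<Prod>i<k. W (x i) (x (Suc i))) * g (x k)"
      unfolding prod.lessThan_Suc by (simp add: g_def mult.assoc del: fun_upd_apply add: fun_upd_apply)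
  qed
  also have "\<dots> = (\<integral>x. walk k x * g x \<partial>M)" by (rule Suc.IH[OF g_meas g_bound])
  also have "\<dots> = (\<integral>x. walk (Suc k) x * f x \<partial>M)"
    unfolding g_def by (rule integral_walk_shift[OF Suc.prems])
  finally show ?case .
qed

lemma integral_path_product_eq_density:
  "(\<integral>x. (\<Prod>i<k. W (x i) (x (Suc i))) \<partial>completion (PiM {0..k} (\<lambda>_. M))) = path_density k"
  using integral_path_product[of "\<lambda>_. 1" 1 k]
  by (simp add: integral_completion path_density_def)

end

section \<open>Passing from graphons to Borel kernels on the unit interval\<close>

abbreviation unit_lborel :: "real measure" where
  "unit_lborel \<equiv> restrict_space lborel {0..1}"

lemma prob_space_unit_lborel: "prob_space unit_lborel"
  by (intro prob_space_restrict_space) auto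

lemma space_unit_lborel: "space unit_lborel = {0..1}"
  by (simp add: space_restrict_space)

text \<open>Each edge meets the exceptional null set with probability zero, and a path has finitely
  many edges, so the two integrands agree almost everywhere.\<close>

lemma hom_density_AE_eq:
  assumes "symmetric_kernel unit_lborel V"
    and AE: "AE p in unit_lborel \<Otimes>\<^sub>M unit_lborel. W (fst p) (snd p) = V (fst p) (snd p)"
  shows "hom_density (path_graph k) W = symmetric_kernel.path_density unit_lborel V k"
proof -
  interpret symmetric_kernel unit_lborel V by fact
  interpret P: product_prob_space "\<lambda>_::nat. unit_lborel" "{0..k}" ..
  let ?P = "PiM {0..k} (\<lambda>_. unit_lborel)"
  have "AE x in ?P. \<forall>i\<in>{..<k}. W (x i) (x (Suc i)) = V (x i) (x (Suc i))"
  proof (rule AE_finite_allI)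
    fix i assume "i \<in> {..<k}"
    then show "AE x in ?P. W (x i) (x (Suc i)) = V (x i) (x (Suc i))"
      using P.AE_PiM_pair[OF _ _ _ AE, of i "Suc i"] by simp
  qed simp
  then have AE_eq: "AE x in ?P. (\<Prod>i<k. W (x i) (x (Suc i))) = (\<Prod>i<k. V (x i) (x (Suc i)))"
    by eventually_elim (auto intro!: prod.cong)
  have "hom_density (path_graph k) W = (\<integral>x. (\<Prod>i<k. W (x i) (x (Suc i))) \<partial>completion ?P)"
    unfolding hom_density_def prod_path_graph_edges by (simp add: path_graph_def)
  also have "\<dots> = (\<integral>x. (\<Prod>i<k. V (x i) (x (Suc i))) \<partial>completion ?P)"
    by (intro integral_cong_AE AE_completion AE_eq measurable_completion measurable_path_product
        borel_measurable_completion_AE[OF measurable_path_product AE_eq])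
  finally show ?thesis by (simp add: integral_path_product_eq_density)
qed

lemma hom_density_kernel:
  assumes "symmetric_kernel unit_lborel V"
  shows "hom_density (path_graph k) V = symmetric_kernel.path_density unit_lborel V k"
  using assms by (rule hom_density_AE_eq) simp

text \<open>The bridge between graphons, which are measurable on the square inside the plane, and
  \<open>symmetric_kernel\<close>, which uses a product of two measures.\<close>

lemma pair_unit_lborel: "unit_lborel \<Otimes>\<^sub>M unit_lborel = restrict_space lborel ({0..1} \<times> {0..1})"
proof (rule pair_measure_eqI)
  show "sigma_finite_measure unit_lborel"
    using prob_space_unit_lborel by (rule prob_space_imp_sigma_finite)
  then show "sigma_finite_measure unit_lborel" .
  have square: "{0..1} \<times> {0..1} \<in> sets (borel :: (real \<times> real) measure)"
    by (intro borel_closed closed_Times) auto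
  show "sets (unit_lborel \<Otimes>\<^sub>M unit_lborel) = sets (restrict_space lborel ({0..1} \<times> {0..1}))"
  proof
    show "sets (unit_lborel \<Otimes>\<^sub>M unit_lborel) \<subseteq> sets (restrict_space lborel ({0..1} \<times> {0..1}))"
    proof (rule sets_pair_in_sets)
      fix A B assume "A \<in> sets unit_lborel" "B \<in> sets unit_lborel"
      then have "A \<in> sets borel" "B \<in> sets borel" "A \<times> B \<subseteq> {0..1} \<times> {0..1}"
        by (auto simp: sets_restrict_space_iff)
      then show "A \<times> B \<in> sets (restrict_space lborel ({0..1} \<times> {0..1}))"
        using square by (auto simp: sets_restrict_space_iff simp flip: borel_prod)
    qed
    show "sets (restrict_space lborel ({0..1} \<times> {0..1})) \<subseteq> sets (unit_lborel \<Otimes>\<^sub>M unit_lborel)"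
    proof
      fix X :: "(real \<times> real) set"
      assume "X \<in> sets (restrict_space lborel ({0..1} \<times> {0..1}))"
      then have X: "X \<in> sets borel" "X \<subseteq> {0..1} \<times> {0..1}"
        using square by (auto simp: sets_restrict_space_iff)
      have [measurable]: "(\<lambda>x. x) \<in> unit_lborel \<rightarrow>\<^sub>M borel"
        by (intro measurable_restrict_space1) simp
      have "(\<lambda>p. (fst p, snd p)) \<in> unit_lborel \<Otimes>\<^sub>M unit_lborel \<rightarrow>\<^sub>M borel \<Otimes>\<^sub>M borel"
        by measurable
      then have "(\<lambda>p. (fst p, snd p)) -` X \<inter> space (unit_lborel \<Otimes>\<^sub>M unit_lborel)
          \<in> sets (unit_lborel \<Otimes>\<^sub>M unit_lborel)"
        using X(1) by (intro measurable_sets) (auto simp: borel_prod)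
      also have "(\<lambda>p. (fst p, snd p)) -` X \<inter> space (unit_lborel \<Otimes>\<^sub>M unit_lborel) = X"
        using X(2) by (auto simp: space_pair_measure space_unit_lborel)
      finally show "X \<in> sets (unit_lborel \<Otimes>\<^sub>M unit_lborel)" .
    qed
  qed
  fix A B assume "A \<in> sets unit_lborel" "B \<in> sets unit_lborel"
  then have AB: "A \<in> sets borel" "B \<in> sets borel" "A \<subseteq> {0..1}" "B \<subseteq> {0..1}"
    by (auto simp: sets_restrict_space_iff)
  then have "A \<times> B \<subseteq> {0..1} \<times> {0..1}" by auto
  with AB show "emeasure unit_lborel A * emeasure unit_lborel B
      = emeasure (restrict_space lborel ({0..1} \<times> {0..1})) (A \<times> B)"
    by (simp add: emeasure_restrict_space lborel.emeasure_pair_measure_Times flip: lborel_prod)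
qed

text \<open>A Borel function \<open>g\<close> agrees with \<open>W\<close> almost everywhere, but
  the locale wants symmetry and bounds at every point; \<open>V\<close> therefore averages
  \<open>g\<close> with its transpose and clamps the result to the unit interval.\<close>

lemma graphon_measurable_version:
  assumes "graphon W"
  obtains V where "symmetric_kernel unit_lborel V"
    and "AE p in unit_lborel \<Otimes>\<^sub>M unit_lborel. W (fst p) (snd p) = V (fst p) (snd p)"
proof -
  interpret U: prob_space unit_lborel by (rule prob_space_unit_lborel)
  interpret UU: pair_sigma_finite unit_lborel unit_lborel ..
  let ?S = "{0..1} \<times> {0..1} :: (real \<times> real) set" and ?M = "unit_lborel \<Otimes>\<^sub>M unit_lborel"
  have range: "0 \<le> W x y" "W x y \<le> 1" "W x y = W y x" if "x \<in> {0..1}" "y \<in> {0..1}" for x y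
    using assms that unfolding graphon_def by auto
  have S_borel: "?S \<in> sets borel" by (intro borel_closed closed_Times) auto
  then have "?S \<in> sets lebesgue" by simp
  then have "(\<lambda>p. case_prod W p * indicator ?S p) \<in> borel_measurable lebesgue"
    using assms unfolding graphon_def
    by (subst (asm) borel_measurable_restrict_space_iff) (auto simp: mult.commute)
  then obtain g where g [measurable]: "g \<in> borel_measurable lborel"
    and "AE p in lborel. case_prod W p * indicator ?S p = g p"
    using completion_ex_borel_measurable_real by blast
  then have "AE p in restrict_space lborel ?S. case_prod W p * indicator ?S p = g p"
    using S_borel by (subst AE_restrict_space_iff) auto
  then have g_eq: "AE p in ?M. W (fst p) (snd p) = g p"
    unfolding pair_unit_lborel by (rule AE_mp) (auto simp: space_restrict_space)
  have [measurable]: "g \<in> borel_measurable ?M"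
    unfolding pair_unit_lborel using g by (rule measurable_restrict_space1)
  define V where "V x y = max 0 (min 1 ((g (x, y) + g (y, x)) / 2))" for x y
  have "symmetric_kernel unit_lborel V"
  proof
    show "case_prod V \<in> borel_measurable ?M" unfolding V_def by measurable
  qed (auto simp: V_def add.commute)
  moreover have "AE p in ?M. W (fst p) (snd p) = V (fst p) (snd p)"
  proof -
    \<comment> \<open>Swapping coordinates preserves the product measure, so the transpose of
      \<open>g\<close> agrees with \<open>W\<close> almost everywhere too. Where both agree,
      averaging and clamping change nothing.\<close>
    have "AE p in distr ?M ?M (\<lambda>(x, y). (y, x)). W (fst p) (snd p) = g p"
      unfolding UU.distr_pair_swap[symmetric] by (rule g_eq)
    then have "AE p in ?M. W (snd p) (fst p) = g (snd p, fst p)"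
      by (auto dest!: AE_distrD[rotated] simp: case_prod_unfold)
    with g_eq AE_space show ?thesis
    proof eventually_elim
      case (elim p)
      then have "fst p \<in> {0..1}" "snd p \<in> {0..1}" by (auto simp: space_pair_measure space_unit_lborel)
      with elim show ?case
        using range[of "fst p" "snd p"] by (simp add: V_def)
    qed
  qed
  ultimately show thesis by (rule that)
qed

section \<open>Bounds on the exponent\<close>

context symmetric_kernel
begin

lemma density_Suc_le: "path_density (Suc k) \<le> path_density k"
  using density_delete_edge[of k 0] by simp

lemma density_decreasing: "i \<le> j \<Longrightarrow> path_density j \<le> path_density i"
  using density_Suc_le by (rule lift_Suc_antimono_le)

text \<open>Log-convexity against length 0 leads from \<open>k\<close> to \<open>2 * k\<close>, and
  monotonicity leads back to \<open>Suc k\<close> once \<open>k\<close> is positive.\<close>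

lemma density_pos:
  assumes "0 < path_density 1"
  shows "0 < path_density k"
proof (induction k)
  case (Suc k)
  show ?case
  proof (cases "k = 0")
    case False
    have "0 < (path_density (0 + k))\<^sup>2" using Suc by simp
    also have "\<dots> \<le> path_density (2 * k)" using density_cauchy_schwarz[of 0 k] by simp
    also have "\<dots> \<le> path_density (Suc k)" using False by (intro density_decreasing) simp
    finally show ?thesis .
  qed (use assms in simp)
qed simp

lemma log_path_profile_ln_density:
  assumes "0 < path_density 1"
  shows "log_path_profile (\<lambda>k. ln (path_density k))"
proof
  note pos = density_pos[OF assms]
  fix a b k :: nat
  show "ln (path_density 0) = 0" by simp
  have "ln ((path_density (a + b))\<^sup>2) \<le> ln (path_density (2 * a) * path_density (2 * b))"
    by (intro ln_le_cancel_iff[THEN iffD2] zero_less_power mult_pos_pos pos density_cauchy_schwarz)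
  then show "2 * ln (path_density (a + b)) \<le> ln (path_density (2 * a)) + ln (path_density (2 * b))"
    using pos by (simp add: ln_mult_pos ln_realpow)
  have "ln (path_density (a + Suc b)) \<le> ln (path_density a * path_density b)"
    by (intro ln_le_cancel_iff[THEN iffD2] zero_less_power mult_pos_pos pos density_delete_edge)
  then show "ln (path_density (a + Suc b)) \<le> ln (path_density a) + ln (path_density b)"
    using pos by (simp add: ln_mult_pos)
  have "ln (path_density k ^ (k + 2)) \<le> ln (path_density (k + 2) ^ k)"
    by (intro ln_le_cancel_iff[THEN iffD2] zero_less_power mult_pos_pos pos density_step)
  then show "real (k + 2) * ln (path_density k) \<le> real k * ln (path_density (k + 2))"
    using pos by (simp only: ln_realpow)
qed

end

text \<open>The logarithm of \<open>path_density m\<close> is negative, so dividing by it reverses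
  the linear bound. Positivity of all path densities excludes the infinite value of
  \<open>log_quotient\<close>.\<close>

lemma exponent_path_graph_le:
  assumes m: "m \<ge> 1" and r: "r > 0"
    and bound: "\<And>l. log_path_profile l \<Longrightarrow> real p * l m \<le> real r * l n"
  shows "density_domination_exponent (path_graph m) (path_graph n) \<le> ennreal (real p / real r)"
  unfolding density_domination_exponent_def
proof (rule SUP_least)
  fix W assume "W \<in> {W. graphon W \<and> hom_density (path_graph m) W \<noteq> 0 \<and> hom_density (path_graph m) W \<noteq> 1}"
  then have W: "graphon W" "hom_density (path_graph m) W \<noteq> 0" "hom_density (path_graph m) W \<noteq> 1"
    by auto
  obtain V where V: "symmetric_kernel unit_lborel V"
    and AE: "AE p in unit_lborel \<Otimes>\<^sub>M unit_lborel. W (fst p) (snd p) = V (fst p) (snd p)"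
    using graphon_measurable_version[OF W(1)] .
  interpret symmetric_kernel unit_lborel V by (rule V)
  note eq = hom_density_AE_eq[OF V AE]
  have w: "0 < path_density m" "path_density m < 1"
    using W(2,3) density_nonneg[of m] density_le_1[of m] unfolding eq by auto
  then have pos: "0 < path_density 1" using density_decreasing[OF m] by simp
  have "real p * ln (path_density m) \<le> real r * ln (path_density n)"
    by (rule bound[OF log_path_profile_ln_density[OF pos]])
  then have "ln (path_density n) / ln (path_density m) \<le> real p / real r"
    using w r ln_less_zero[OF w] by (simp add: divide_simps mult_ac)
  then show "log_quotient (hom_density (path_graph n) W) (hom_density (path_graph m) W)
      \<le> ennreal (real p / real r)"
    using density_pos[OF pos, of n] unfolding eq log_quotient_def by (simp add: ennreal_leI)
qed

lemma graphon_kernel: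
  assumes "symmetric_kernel unit_lborel V"
  shows "graphon V"
proof -
  interpret symmetric_kernel unit_lborel V by fact
  have S: "{0..1} \<times> {0..1} \<in> sets (borel :: (real \<times> real) measure)"
    by (intro borel_closed closed_Times) auto
  have "case_prod V \<in> borel_measurable (restrict_space lborel ({0..1} \<times> {0..1}))"
    using measurable_W unfolding pair_unit_lborel .
  then have "case_prod V \<in> borel_measurable (lebesgue_on ({0..1} \<times> {0..1}))"
    using S by (subst (asm) borel_measurable_restrict_space_iff, simp,
        subst borel_measurable_restrict_space_iff) (auto intro: measurable_completion)
  then show ?thesis
    using W_nonneg W_le_1 W_sym unfolding graphon_def by (simp add: space_unit_lborel)
qed

lemma le_exponent_path_graph:
  assumes "symmetric_kernel unit_lborel V"
    and "symmetric_kernel.path_density unit_lborel V m = s" "0 < s" "s < 1"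
    and "symmetric_kernel.path_density unit_lborel V n = t" "0 < t"
  shows "ennreal (ln t / ln s) \<le> density_domination_exponent (path_graph m) (path_graph n)"
proof -
  have "log_quotient (hom_density (path_graph n) V) (hom_density (path_graph m) V)
      \<le> density_domination_exponent (path_graph m) (path_graph n)"
    unfolding density_domination_exponent_def
    using assms by (intro SUP_upper) (simp add: graphon_kernel hom_density_kernel)
  then show ?thesis
    using assms by (simp add: hom_density_kernel log_quotient_def)
qed

section \<open>Path densities of constant, clique and complete bipartite kernels\<close>

context prob_space
begin

lemma constant_kernel:
  assumes "0 \<le> c" "c \<le> 1"
  shows "symmetric_kernel M (\<lambda>_ _. c)"
    and "symmetric_kernel.path_density M (\<lambda>_ _. c) k = c ^ k"
proof -
  show K: "symmetric_kernel M (\<lambda>_ _. c)"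
    using assms by unfold_locales auto
  interpret symmetric_kernel M "\<lambda>_ _. c" by (rule K)
  have "walk k x = c ^ k" for x by (induction k arbitrary: x) (simp_all add: prob_space)
  then show "path_density k = c ^ k" by (simp add: path_density_def prob_space)
qed

text \<open>Edges force all \<open>k + 1\<close> vertices into \<open>A\<close>. The single vertex
  of \<open>P_0\<close> is not forced, hence \<open>k \<ge> 1\<close>.\<close>

lemma clique_kernel:
  assumes A [measurable]: "A \<in> sets M"
  shows "symmetric_kernel M (\<lambda>x y. indicator A x * indicator A y)"
    and "k \<ge> 1 \<Longrightarrow>
      symmetric_kernel.path_density M (\<lambda>x y. indicator A x * indicator A y) k = prob A ^ (k + 1)"
proof -
  show K: "symmetric_kernel M (\<lambda>x y. indicator A x * indicator A y)"
    by unfold_locales (auto simp: indicator_def)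
  interpret symmetric_kernel M "\<lambda>x y. indicator A x * indicator A y" by (rule K)
  have walk: "walk (Suc j) x = indicator A x * prob A ^ Suc j" for j x
  proof (induction j arbitrary: x)
    case (Suc j)
    have "walk (Suc (Suc j)) x = (\<integral>y. indicator A x * prob A ^ Suc j * indicator A y \<partial>M)"
      unfolding walk.simps(2)[of "Suc j"] Suc
      by (intro Bochner_Integration.integral_cong) (auto simp: indicator_def)
    then show ?case by simp
  qed simp
  show "path_density k = prob A ^ (k + 1)" if "k \<ge> 1"
    using that by (cases k) (simp_all add: path_density_def walk del: walk.simps(2))
qed

text \<open>Walks alternate between \<open>A\<close> and its complement, so any two consecutive
  steps contribute \<open>a * (1 - a)\<close>, wherever they start. The factor 2 at odd lengths
  counts the two sides on which a walk can start.\<close>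

lemma bipartite_kernel:
  fixes A :: "'a set"
  defines "V \<equiv> \<lambda>x y. indicator A x * (1 - indicator A y) + (1 - indicator A x) * indicator A y"
  assumes A [measurable]: "A \<in> sets M"
  shows "symmetric_kernel M V"
    and "symmetric_kernel.path_density M V (2 * j) = (prob A * (1 - prob A)) ^ j"
    and "symmetric_kernel.path_density M V (2 * j + 1) = 2 * (prob A * (1 - prob A)) ^ (j + 1)"
proof -
  show K: "symmetric_kernel M V"
    unfolding V_def by unfold_locales (auto simp: indicator_def)
  interpret symmetric_kernel M V by (rule K)
  define a where "a = prob A"
  have int: "(\<integral>y. s * indicator A y + t * (1 - indicator A y) \<partial>M) = s * a + t * (1 - a)" for s t
  proof -
    have "integrable M (\<lambda>y. (s - t) * indicator A y)"
      by (intro integrable_mult_right integrable_real_indicator) (simp_all add: less_top[symmetric])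
    then have "(\<integral>y. (s - t) * indicator A y + t \<partial>M) = (s - t) * a + t"
      by (simp add: a_def prob_space)
    moreover have "s * indicator A y + t * (1 - indicator A y) = (s - t) * indicator A y + t" for y
      by (simp add: algebra_simps)
    ultimately show ?thesis by (simp add: algebra_simps)
  qed
  \<comment> \<open>Conditional on the even case, so that the induction on
    \<open>walk (2 * j)\<close> can use it for its intermediate odd step.\<close>
  have one: "walk (2 * j + 1) x = (a * (1 - a)) ^ j * (indicator A x * (1 - a) + (1 - indicator A x) * a)"
    if even: "\<And>y. walk (2 * j) y = (a * (1 - a)) ^ j" for x j
  proof -
    have "walk (2 * j + 1) x = (\<integral>y. V x y * walk (2 * j) y \<partial>M)" by simp
    also have "\<dots> = (\<integral>y. (1 - indicator A x) * (a * (1 - a)) ^ j * indicator A y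
        + indicator A x * (a * (1 - a)) ^ j * (1 - indicator A y) \<partial>M)"
      unfolding even by (intro Bochner_Integration.integral_cong) (auto simp: V_def indicator_def)
    finally show ?thesis unfolding int by (simp add: algebra_simps)
  qed
  have walk: "walk (2 * j) x = (a * (1 - a)) ^ j" for j x
  proof (induction j arbitrary: x)
    case (Suc j)
    have "walk (2 * Suc j) x = (\<integral>y. V x y * walk (2 * j + 1) y \<partial>M)" by simp
    also have "\<dots> = (\<integral>y. (1 - indicator A x) * (a * (1 - a)) ^ j * (1 - a) * indicator A y
        + indicator A x * (a * (1 - a)) ^ j * a * (1 - indicator A y) \<partial>M)"
      unfolding one[OF Suc]
      by (intro Bochner_Integration.integral_cong) (auto simp: V_def indicator_def)
    also have "\<dots> = (a * (1 - a)) ^ Suc j"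
      unfolding int by (auto simp: indicator_def)
    finally show ?case .
  qed simp
  show "path_density (2 * j) = (prob A * (1 - prob A)) ^ j"
    unfolding path_density_def walk by (simp add: a_def prob_space)
  have "path_density (2 * j + 1) = (\<integral>x. (a * (1 - a)) ^ j * (1 - a) * indicator A x
      + (a * (1 - a)) ^ j * a * (1 - indicator A x) \<partial>M)"
    unfolding path_density_def one[OF walk]
    by (intro Bochner_Integration.integral_cong) (auto simp: indicator_def)
  then show "path_density (2 * j + 1) = 2 * (prob A * (1 - prob A)) ^ (j + 1)"
    unfolding int by (simp add: a_def algebra_simps)
qed

end

section \<open>Lower bounds from kernels on the unit interval\<close>

lemma measure_unit_lborel: "0 \<le> a \<Longrightarrow> a \<le> 1 \<Longrightarrow> measure unit_lborel {0..a} = a"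
  by (subst measure_restrict_space) auto

lemma sets_unit_lborel: "a \<le> 1 \<Longrightarrow> {0..a} \<in> sets unit_lborel"
  by (subst sets_restrict_space_iff) auto

lemma exponent_path_graph_ge_edges:
  assumes "m \<ge> 1"
  shows "ennreal (real n / real m) \<le> density_domination_exponent (path_graph m) (path_graph n)"
proof -
  interpret prob_space unit_lborel by (rule prob_space_unit_lborel)
  have "ennreal (ln ((1 / 2) ^ n) / ln ((1 / 2) ^ m))
      \<le> density_domination_exponent (path_graph m) (path_graph n)"
    using assms
    by (intro le_exponent_path_graph[OF constant_kernel(1) constant_kernel(2) _ _ constant_kernel(2)])
      (auto simp: power_less_one_iff)
  also have "ln ((1 / 2) ^ n) / ln ((1 / 2) ^ m :: real) = real n / real m"
    by (simp only: ln_realpow) (simp add: ln_div)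
  finally show ?thesis .
qed

lemma exponent_path_graph_ge_vertices:
  assumes "m \<ge> 1" "n \<ge> 1"
  shows "ennreal (real (n + 1) / real (m + 1))
    \<le> density_domination_exponent (path_graph m) (path_graph n)"
proof -
  interpret prob_space unit_lborel by (rule prob_space_unit_lborel)
  have A: "{0..1 / 2} \<in> sets unit_lborel" "prob {0..1 / 2} = 1 / 2"
    by (simp_all add: sets_unit_lborel measure_unit_lborel)
  have "(1 / 2) ^ (m + 1) < (1 :: real)" by (subst power_less_one_iff) auto
  then have "ennreal (ln ((1 / 2) ^ (n + 1)) / ln ((1 / 2) ^ (m + 1)))
      \<le> density_domination_exponent (path_graph m) (path_graph n)"
    using clique_kernel(2)[OF A(1)] assms
    by (intro le_exponent_path_graph[OF clique_kernel(1)[OF A(1)]]) (simp_all add: A(2))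
  also have "ln ((1 / 2) ^ (n + 1)) / ln ((1 / 2) ^ (m + 1) :: real) = real (n + 1) / real (m + 1)"
    by (simp only: ln_realpow) (simp add: ln_div)
  finally show ?thesis .
qed

text \<open>Each quotient stays below the bound: the factor 2 in the odd density adds the negative
  term \<open>ln 2 / (q * ln (b N))\<close>, which vanishes only as \<open>b N\<close> tends to 0.
  Hence the limit.\<close>

lemma exponent_path_graph_ge_bipartite:
  assumes "m \<ge> 1" "even m" "odd n"
  shows "ennreal (real (n + 1) / real m) \<le> density_domination_exponent (path_graph m) (path_graph n)"
proof -
  interpret prob_space unit_lborel by (rule prob_space_unit_lborel)
  obtain p q where n: "n = 2 * p + 1" and m: "m = 2 * q" using assms(2,3) by (auto elim!: oddE evenE)
  \<comment> \<open>The double successor keeps \<open>a N\<close> at most \<open>1 / 2\<close>, so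
    both parts have positive measure already at \<open>N = 0\<close>.\<close>
  define a where "a N = inverse (real (Suc (Suc N)))" for N
  define b where "b N = a N * (1 - a N)" for N
  have a: "0 < a N" "a N < 1" for N by (auto simp: a_def divide_simps)
  then have b: "0 < b N" "b N < 1" for N
    by (auto simp: b_def intro!: mult_pos_pos) (smt (verit) mult_less_cancel_right2 mult_nonneg_nonneg)
  have le: "ennreal (ln (2 * b N ^ (p + 1)) / ln (b N ^ q))
      \<le> density_domination_exponent (path_graph m) (path_graph n)" for N
  proof -
    have A: "{0..a N} \<in> sets unit_lborel" "prob {0..a N} = a N"
      using a[of N] by (simp_all add: sets_unit_lborel measure_unit_lborel)
    show ?thesis
      using le_exponent_path_graph[OF bipartite_kernel(1)[OF A(1)]
        bipartite_kernel(2)[OF A(1)] _ _ bipartite_kernel(3)[OF A(1)], of q p] b[of N] assms(1)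
      by (auto simp: power_less_one_iff A(2) m n simp flip: b_def)
  qed
  have quotient: "ln (2 * b N ^ (p + 1)) / ln (b N ^ q)
      = real (p + 1) / real q + ln 2 / real q * inverse (ln (b N))" for N
    using b[of N] ln_less_zero[OF b[of N]] assms(1) m
    by (simp add: ln_mult_pos ln_realpow field_simps)
  have "a \<longlonglongrightarrow> 0" unfolding a_def by (rule LIMSEQ_Suc[OF LIMSEQ_inverse_real_of_nat])
  then have "b \<longlonglongrightarrow> 0 * (1 - 0)" unfolding b_def by (intro tendsto_intros)
  then have "filterlim b (at_right 0) sequentially"
    using b(1) by (intro tendsto_imp_filterlim_at_right) auto
  then have "filterlim (\<lambda>N. ln (b N)) at_bot sequentially" by (rule filterlim_compose[OF ln_at_0])
  then have "(\<lambda>N. inverse (ln (b N))) \<longlonglongrightarrow> 0"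
    by (intro tendsto_inverse_0[THEN filterlim_compose]) (rule filterlim_mono[OF _ at_bot_le_at_infinity order_refl])
  then have "(\<lambda>N. ln (2 * b N ^ (p + 1)) / ln (b N ^ q)) \<longlonglongrightarrow> real (p + 1) / real q + ln 2 / real q * 0"
    unfolding quotient by (intro tendsto_intros)
  then have "(\<lambda>N. ennreal (ln (2 * b N ^ (p + 1)) / ln (b N ^ q))) \<longlonglongrightarrow> ennreal (real (p + 1) / real q)"
    by (intro tendsto_ennrealI) simp
  then have "ennreal (real (p + 1) / real q) \<le> density_domination_exponent (path_graph m) (path_graph n)"
    using le by (intro LIMSEQ_le_const2) auto
  moreover have "real (n + 1) = 2 * real (p + 1)" "real m = 2 * real q" by (simp_all add: m n)
  ultimately show ?thesis by (simp only: mult_divide_mult_cancel_left_if) simp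
qed

theorem theorem4p1:
  fixes m n :: nat
  assumes "m \<ge> 1" and "n \<ge> 1"
  shows
    "(n > m \<and> even n \<longrightarrow>
        density_domination_exponent (path_graph m) (path_graph n) = ennreal (real n / real m)) \<and>
     (n > m \<and> odd n \<and> odd m \<longrightarrow>
        density_domination_exponent (path_graph m) (path_graph n) = ennreal (real n / real m)) \<and>
     (odd n \<and> even m \<longrightarrow>
        density_domination_exponent (path_graph m) (path_graph n) = ennreal (real (n + 1) / real m)) \<and>
     (n < m \<and> even n \<longrightarrow>
        density_domination_exponent (path_graph m) (path_graph n)
          = ennreal (real (n + 1) / real (m + 1))) \<and>
     (n < m \<and> odd n \<and> odd m \<and> (n + 1) dvd (m + 1) \<longrightarrow>
        density_domination_exponent (path_graph m) (path_graph n)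
          = ennreal (real (n + 1) / real (m + 1)))"
proof (intro conjI impI antisym)
  note upper = exponent_path_graph_le[OF assms(1)]
  {
    assume "n > m \<and> even n"
    then show "density_domination_exponent (path_graph m) (path_graph n) \<le> ennreal (real n / real m)"
      using assms(1) by (intro upper log_path_profile.upper_longer) auto
  next
    assume "n > m \<and> odd n \<and> odd m"
    then show "density_domination_exponent (path_graph m) (path_graph n) \<le> ennreal (real n / real m)"
      using assms(1) by (intro upper log_path_profile.upper_longer) auto
  next
    assume "odd n \<and> even m"
    then show "density_domination_exponent (path_graph m) (path_graph n) \<le> ennreal (real (n + 1) / real m)"
      using assms(1) by (intro upper log_path_profile.upper_odd_even) auto
  next
    assume "n < m \<and> even n"
    then show "density_domination_exponent (path_graph m) (path_graph n)
        \<le> ennreal (real (n + 1) / real (m + 1))"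
      by (intro upper log_path_profile.upper_shorter_even) auto
  next
    assume "n < m \<and> odd n \<and> odd m \<and> (n + 1) dvd (m + 1)"
    then show "density_domination_exponent (path_graph m) (path_graph n)
        \<le> ennreal (real (n + 1) / real (m + 1))"
      by (intro upper log_path_profile.upper_dvd) auto
  }
\<comment> \<open>What \<open>antisym\<close> leaves are the five lower bounds: constant kernels for
  \<open>n / m\<close>, bipartite ones for \<open>(n + 1) / m\<close>, cliques for
  \<open>(n + 1) / (m + 1)\<close>.\<close>
qed (use exponent_path_graph_ge_edges exponent_path_graph_ge_vertices exponent_path_graph_ge_bipartite assms
  in \<open>auto\<close>)

end
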